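(* Let $F$ be the realization of a neural network with $\mathcal{L}(F)>0$. Fix an architecture $\chi^\star$, let $\mathcal{W}^\star$ be a maximizer of $(\mathbf{y}-\mathbf{H}F)\cdot\mathbf{H}\mathcal{R}(\mathcal{W})$ over all $\mathcal{W}\in\mathfrak{W}(\chi^\star)$ with $|\mathbf{H}\mathcal{R}(\mathcal{W})|\le1$, and define $$C_{\rm opt}:=\frac{2(\mathbf{y}-\mathbf{H}F)\cdot\mathbf{H}\mathcal{R}(\mathcal{W}^\star)}{\sqrt{\mathcal{L}(F)}} .$$ Then $$\mathcal{L}(F)\le2\,\mathcal{L}(F+G)$$ for all architectures $\chi$ and all networks $G\in\mathcal{R}(\chi)$ that satisfy the implication (I) for $F$ with a constant $L>0$ and for which $\#\chi/\#\chi^\star\le\frac{1}{16L^2C_{\rm opt}^2}$ (the right-hand side being read as $+\infty$ if $C_{\rm opt}=0$).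
   Context: Networks. Fix $\delta_{\rm ReLU}\in[0,1)$ and $\phi(x):=\max\{x,\delta_{\rm ReLU}x\}$, applied entrywise to vectors. An architecture is a tuple $\chi=(w_0,\dots,w_{d+1})$ of positive integers with $w_{d+1}=1$. The weight set is $\mathfrak{W}(\chi):=\{\mathcal{W}=(W_0,B_0,\dots,W_d,B_d): W_i\in\mathbb{R}^{w_{i+1}\times w_i},\ B_i\in\mathbb{R}^{w_{i+1}}\}$. The realization $\mathcal{R}(\mathcal{W}):\mathbb{R}^{w_0}\to\mathbb{R}$ is $\mathcal{R}_d$, where $\mathcal{R}_0(x)=W_0x+B_0$ and $\mathcal{R}_i(x)=W_i\phi(\mathcal{R}_{i-1}(x))+B_i$, $i=1,\dots,d$. $\mathcal{R}(\chi):=\{\mathcal{R}(\mathcal{W}):\mathcal{W}\in\mathfrak{W}(\chi)\}$ and $\#\chi:=\sum_{i=0}^d(w_i+1)w_{i+1}$. All networks share the input width $w_0$. Loss. Training data $x_1,\dots,x_n\in\mathbb{R}^{w_0}$ and responses $\mathbf{y}=(y_i)_{i=1}^n\in\mathbb{R}^n$ are given. $|\cdot|$ is a (semi)norm on $\mathbb{R}^n$ induced by a (semi-definite) inner product denoted by a dot. $H$ is a linear operator mapping realizations of networks to functions $\mathbb{R}^{w_0}\to\mathbb{R}$, and $\mathbf{H}F:=((HF)(x_i))_{i=1}^n\in\mathbb{R}^n$. The loss is $\mathcal{L}(F):=|\mathbf{y}-\mathbf{H}F|^2$. Implication (I). $G\in\mathcal{R}(\chi)$ satisfies (I) for $F$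 with constant $L$ if for every $\gamma>0$: $$\frac{(\mathbf{y}-\mathbf{H}F)\cdot\mathbf{H}G}{|\mathbf{y}-\mathbf{H}F||\mathbf{H}G|}\ge\gamma\quad\Longrightarrow\quad \frac{(\mathbf{y}-\mathbf{H}F)\cdot\mathbf{H}\mathcal{R}(\mathcal{W}^\star)}{|\mathbf{y}-\mathbf{H}F||\mathbf{H}\mathcal{R}(\mathcal{W}^\star)|}\ge\frac{\gamma}{L\sqrt{\#\chi/\#\chi^\star}},$$ with $\mathcal{W}^\star$ the maximizer (assumed to exist) described in the claim. *)

theory Defs
  imports Complex_Main "HOL-Library.FuncSet" "Jordan_Normal_Form.Matrix"
begin

text \<open>
  \<open>\<real>\<^sup>m\<close> is \<open>carrier_vec m\<close>, and a function \<open>\<real>\<^sup>m \<rightarrow> \<real>\<close> is an element of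
  \<open>carrier_vec m \<rightarrow>\<^sub>E UNIV\<close>, so that two such functions are equal iff they agree on \<open>\<real>\<^sup>m\<close>.
\<close>

definition fun_plus :: "nat \<Rightarrow> (real vec \<Rightarrow> real) \<Rightarrow> (real vec \<Rightarrow> real) \<Rightarrow> real vec \<Rightarrow> real" where
  "fun_plus m f g = (\<lambda>x\<in>carrier_vec m. f x + g x)"

definition fun_scale :: "nat \<Rightarrow> real \<Rightarrow> (real vec \<Rightarrow> real) \<Rightarrow> real vec \<Rightarrow> real" where
  "fun_scale m c f = (\<lambda>x\<in>carrier_vec m. c * f x)"


definition relu :: "real \<Rightarrow> real \<Rightarrow> real" where
  "relu \<delta> x = max x (\<delta> * x)"

text \<open>
  The tuple \<open>(w\<^sub>0, \<dots>, w\<^sub>d\<^sub>+\<^sub>1)\<close> with \<open>d \<ge> 0\<close> is a list of length \<open>d + 2\<close>, and the weights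
  \<open>(W\<^sub>0, B\<^sub>0, \<dots>, W\<^sub>d, B\<^sub>d)\<close> are the list of the \<open>d + 1\<close> pairs \<open>(W\<^sub>i, B\<^sub>i)\<close>.
\<close>

definition architecture :: "nat \<Rightarrow> nat list \<Rightarrow> bool" where
  "architecture m \<chi> \<longleftrightarrow> 2 \<le> length \<chi> \<and> (\<forall>w\<in>set \<chi>. 0 < w) \<and> hd \<chi> = m \<and> last \<chi> = 1"

definition weight_set :: "nat list \<Rightarrow> (real mat \<times> real vec) list set" where
  "weight_set \<chi> = {Ws. length Ws = length \<chi> - 1 \<and>
     (\<forall>i<length Ws. fst (Ws ! i) \<in> carrier_mat (\<chi> ! Suc i) (\<chi> ! i) \<and>
                    snd (Ws ! i) \<in> carrier_vec (\<chi> ! Suc i))}"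

primrec layer :: "real \<Rightarrow> (real mat \<times> real vec) list \<Rightarrow> nat \<Rightarrow> real vec \<Rightarrow> real vec" where
  "layer \<delta> Ws 0 x = fst (Ws ! 0) *\<^sub>v x + snd (Ws ! 0)"
| "layer \<delta> Ws (Suc i) x =
     fst (Ws ! Suc i) *\<^sub>v map_vec (relu \<delta>) (layer \<delta> Ws i x) + snd (Ws ! Suc i)"

text \<open>The last layer has width 1; its single entry is the real-valued output.\<close>

definition realization :: "real \<Rightarrow> (real mat \<times> real vec) list \<Rightarrow> real vec \<Rightarrow> real" where
  "realization \<delta> Ws = (\<lambda>x\<in>carrier_vec (dim_col (fst (Ws ! 0))). layer \<delta> Ws (length Ws - 1) x $ 0)"

definition realizations :: "real \<Rightarrow> nat list \<Rightarrow> (real vec \<Rightarrow> real) set" where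
  "realizations \<delta> \<chi> = realization \<delta> ` weight_set \<chi>"

definition num_params :: "nat list \<Rightarrow> nat" where
  "num_params \<chi> = (\<Sum>i<length \<chi> - 1. (\<chi> ! i + 1) * \<chi> ! Suc i)"

definition network_functions :: "real \<Rightarrow> nat \<Rightarrow> (real vec \<Rightarrow> real) set" where
  "network_functions \<delta> m = (\<Union>\<chi>\<in>{\<chi>. architecture m \<chi>}. realizations \<delta> \<chi>)"


text \<open>
  For \<open>0 \<le> \<delta> < 1\<close> the set \<open>network_functions \<delta> m\<close> is a vector space: networks of different depths
  can be added since \<open>relu \<delta> t - relu \<delta> (- t) = (1 + \<delta>) * t\<close> yields identity layers.
  Linearity is required on this space only.
\<close>

definition linear_operator ::
    "real \<Rightarrow> nat \<Rightarrow> ((real vec \<Rightarrow> real) \<Rightarrow> real vec \<Rightarrow> real) \<Rightarrow> bool" where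
  "linear_operator \<delta> m H \<longleftrightarrow>
     H \<in> network_functions \<delta> m \<rightarrow> (carrier_vec m \<rightarrow>\<^sub>E UNIV) \<and>
     (\<forall>F\<in>network_functions \<delta> m. \<forall>G\<in>network_functions \<delta> m.
        H (fun_plus m F G) = fun_plus m (H F) (H G)) \<and>
     (\<forall>F\<in>network_functions \<delta> m. \<forall>c. H (fun_scale m c F) = fun_scale m c (H F))"

definition semi_inner_product :: "nat \<Rightarrow> (real vec \<Rightarrow> real vec \<Rightarrow> real) \<Rightarrow> bool" where
  "semi_inner_product n ip \<longleftrightarrow>
     (\<forall>u\<in>carrier_vec n. \<forall>v\<in>carrier_vec n. ip u v = ip v u) \<and>
     (\<forall>u\<in>carrier_vec n. \<forall>v\<in>carrier_vec n. \<forall>w\<in>carrier_vec n. ip (u + v) w = ip u w + ip v w) \<and>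
     (\<forall>u\<in>carrier_vec n. \<forall>v\<in>carrier_vec n. \<forall>c. ip (c \<cdot>\<^sub>v u) v = c * ip u v) \<and>
     (\<forall>u\<in>carrier_vec n. 0 \<le> ip u u)"

definition seminorm :: "(real vec \<Rightarrow> real vec \<Rightarrow> real) \<Rightarrow> real vec \<Rightarrow> real" where
  "seminorm ip v = sqrt (ip v v)"

definition data_vec ::
    "nat \<Rightarrow> (nat \<Rightarrow> real vec) \<Rightarrow> ((real vec \<Rightarrow> real) \<Rightarrow> real vec \<Rightarrow> real) \<Rightarrow>
     (real vec \<Rightarrow> real) \<Rightarrow> real vec" where
  "data_vec n x H F = vec n (\<lambda>i. H F (x i))"

definition loss ::
    "nat \<Rightarrow> (real vec \<Rightarrow> real vec \<Rightarrow> real) \<Rightarrow> (nat \<Rightarrow> real vec) \<Rightarrow> real vec \<Rightarrow>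
     ((real vec \<Rightarrow> real) \<Rightarrow> real vec \<Rightarrow> real) \<Rightarrow> (real vec \<Rightarrow> real) \<Rightarrow> real" where
  "loss n ip x y H F = (seminorm ip (y - data_vec n x H F))\<^sup>2"

text \<open>
  The cosine between the residual \<open>y - \<^bold>HF\<close> and \<open>\<^bold>HG\<close>. It is \<open>0\<close> if \<open>|\<^bold>HG| = 0\<close>, because
  division by zero yields zero; a quotient \<open>0/0\<close> thus never satisfies \<open>0/0 \<ge> t\<close> with \<open>t > 0\<close>.
\<close>

definition alignment ::
    "nat \<Rightarrow> (real vec \<Rightarrow> real vec \<Rightarrow> real) \<Rightarrow> (nat \<Rightarrow> real vec) \<Rightarrow> real vec \<Rightarrow>
     ((real vec \<Rightarrow> real) \<Rightarrow> real vec \<Rightarrow> real) \<Rightarrow> (real vec \<Rightarrow> real) \<Rightarrow> (real vec \<Rightarrow> real) \<Rightarrow> real" where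
  "alignment n ip x y H F G =
     ip (y - data_vec n x H F) (data_vec n x H G) /
     (seminorm ip (y - data_vec n x H F) * seminorm ip (data_vec n x H G))"

definition optimal_weights ::
    "real \<Rightarrow> nat \<Rightarrow> (real vec \<Rightarrow> real vec \<Rightarrow> real) \<Rightarrow> (nat \<Rightarrow> real vec) \<Rightarrow> real vec \<Rightarrow>
     ((real vec \<Rightarrow> real) \<Rightarrow> real vec \<Rightarrow> real) \<Rightarrow> (real vec \<Rightarrow> real) \<Rightarrow> nat list \<Rightarrow>
     (real mat \<times> real vec) list \<Rightarrow> bool" where
  "optimal_weights \<delta> n ip x y H F \<chi> =
     is_arg_max (\<lambda>W. ip (y - data_vec n x H F) (data_vec n x H (realization \<delta> W)))
       (\<lambda>W. W \<in> weight_set \<chi> \<and> seminorm ip (data_vec n x H (realization \<delta> W)) \<le> 1)"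

definition C_opt ::
    "real \<Rightarrow> nat \<Rightarrow> (real vec \<Rightarrow> real vec \<Rightarrow> real) \<Rightarrow> (nat \<Rightarrow> real vec) \<Rightarrow> real vec \<Rightarrow>
     ((real vec \<Rightarrow> real) \<Rightarrow> real vec \<Rightarrow> real) \<Rightarrow> (real vec \<Rightarrow> real) \<Rightarrow>
     (real mat \<times> real vec) list \<Rightarrow> real" where
  "C_opt \<delta> n ip x y H F W =
     2 * ip (y - data_vec n x H F) (data_vec n x H (realization \<delta> W)) / sqrt (loss n ip x y H F)"

text \<open>
  Implication (I) for \<open>F\<close> with constant \<open>L\<close>, where \<open>G\<close> is a realization of the architecture \<open>\<chi>\<close>
  and \<open>W'\<close> are the optimal weights for the architecture \<open>\<chi>'\<close>.
\<close>

definition implication_I ::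
    "real \<Rightarrow> nat \<Rightarrow> (real vec \<Rightarrow> real vec \<Rightarrow> real) \<Rightarrow> (nat \<Rightarrow> real vec) \<Rightarrow> real vec \<Rightarrow>
     ((real vec \<Rightarrow> real) \<Rightarrow> real vec \<Rightarrow> real) \<Rightarrow> (real vec \<Rightarrow> real) \<Rightarrow>
     nat list \<Rightarrow> (real mat \<times> real vec) list \<Rightarrow> nat list \<Rightarrow> (real vec \<Rightarrow> real) \<Rightarrow> real \<Rightarrow> bool" where
  "implication_I \<delta> n ip x y H F \<chi>' W' \<chi> G L \<longleftrightarrow>
     (\<forall>\<gamma>>0. alignment n ip x y H F G \<ge> \<gamma> \<longrightarrow>
        alignment n ip x y H F (realization \<delta> W')
          \<ge> \<gamma> / (L * sqrt (real (num_params \<chi>) / real (num_params \<chi>'))))"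

end

theory Submission
  imports Defs
begin

text \<open>
  Write \<open>r = y - \<^bold>HF\<close> for the residual, \<open>g = \<^bold>HG\<close> and \<open>h = \<^bold>H\<R>(\<W>\<^sup>\<star>)\<close>. By linearity of \<open>H\<close>, the
  network \<open>F + G\<close> has residual \<open>r - g\<close>. Hence a small cosine between \<open>r\<close> and \<open>g\<close> means that
  subtracting \<open>g\<close> cannot shorten \<open>r\<close> by much: if the cosine is at most \<open>c \<ge> 0\<close>, then
  \<open>|r - g|\<^sup>2 \<ge> (1 - c\<^sup>2) |r|\<^sup>2\<close>, whatever the length of \<open>g\<close> (\<open>sq_norm_diff_ge_of_cosine_le\<close>).

  The number of parameters of \<open>G\<close> bounds this cosine. The set of realizations of a fixed
  architecture is closed under scaling, because the last layer is affine and can be multiplied by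
  any constant (\<open>realization_scale_output\<close>). A maximizer with \<open>r \<cdot> h > 0\<close> therefore exhausts
  the constraint \<open>|h| \<le> 1\<close>, and the cosine between \<open>r\<close> and \<open>h\<close> is at most
  \<open>r \<cdot> h / |r| = C\<^sub>o\<^sub>p\<^sub>t / 2\<close> (\<open>alignment_optimal_le\<close>). Suppose that the cosine \<open>\<gamma>\<close> between \<open>r\<close> and
  \<open>g\<close> is positive. The implication (I), applied with this \<open>\<gamma>\<close>, and the bound on the number of
  parameters yield \<open>C\<^sub>o\<^sub>p\<^sub>t > 0\<close> and
  \[ \gamma \le L \sqrt{\#\chi / \#\chi^\star} \cdot \frac{C_{opt}}{2}
       \le \frac{1}{4 C_{opt}} \cdot \frac{C_{opt}}{2} = \frac18 , \]
  and a cosine that is not positive is at most \<open>1/8\<close> anyway. So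
  \<open>\<L>(F + G) \<ge> (1 - 1/64) \<L>(F)\<close>, which is stronger than the claim.
\<close>


section \<open>Semi-inner products\<close>

lemma semi_inner_product_commute:
  assumes "semi_inner_product n ip" "u \<in> carrier_vec n" "v \<in> carrier_vec n"
  shows "ip u v = ip v u"
  using assms unfolding semi_inner_product_def by blast

lemma semi_inner_product_nonneg:
  assumes "semi_inner_product n ip" "u \<in> carrier_vec n"
  shows "0 \<le> ip u u"
  using assms unfolding semi_inner_product_def by blast

lemma semi_inner_product_add_left:
  assumes "semi_inner_product n ip" "u \<in> carrier_vec n" "v \<in> carrier_vec n" "w \<in> carrier_vec n"
  shows "ip (u + v) w = ip u w + ip v w"
  using assms unfolding semi_inner_product_def by blast

lemma semi_inner_product_smult_left:
  assumes "semi_inner_product n ip" "u \<in> carrier_vec n" "v \<in> carrier_vec n"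
  shows "ip (c \<cdot>\<^sub>v u) v = c * ip u v"
  using assms unfolding semi_inner_product_def by blast

lemma semi_inner_product_smult_right:
  assumes "semi_inner_product n ip" "u \<in> carrier_vec n" "v \<in> carrier_vec n"
  shows "ip u (c \<cdot>\<^sub>v v) = c * ip u v"
proof -
  have "ip u (c \<cdot>\<^sub>v v) = ip (c \<cdot>\<^sub>v v) u"
    using assms by (intro semi_inner_product_commute) auto
  also have "\<dots> = c * ip v u"
    using assms by (intro semi_inner_product_smult_left)
  also have "ip v u = ip u v"
    using assms by (intro semi_inner_product_commute)
  finally show ?thesis .
qed

lemma semi_inner_product_add_smult_self:
  assumes ip: "semi_inner_product n ip" and u: "u \<in> carrier_vec n" and v: "v \<in> carrier_vec n"
  shows "ip (u + t \<cdot>\<^sub>v v) (u + t \<cdot>\<^sub>v v) = ip u u + 2 * t * ip u v + t\<^sup>2 * ip v v"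
proof -
  let ?w = "t \<cdot>\<^sub>v v"
  have w: "?w \<in> carrier_vec n" and uw: "u + ?w \<in> carrier_vec n"
    using u v by auto
  have "ip (u + ?w) (u + ?w) = ip (u + ?w) u + ip (u + ?w) ?w"
    using semi_inner_product_add_left[OF ip u w uw] semi_inner_product_commute[OF ip uw u]
      semi_inner_product_commute[OF ip uw w] by simp
  also have "\<dots> = (ip u u + ip ?w u) + (ip u ?w + ip ?w ?w)"
    using semi_inner_product_add_left[OF ip u w] u w by simp
  also have "\<dots> = ip u u + 2 * t * ip u v + t\<^sup>2 * ip v v"
  proof -
    have ip_uw: "ip u ?w = t * ip u v"
      using semi_inner_product_smult_right[OF ip u v] .
    have ip_wu: "ip ?w u = t * ip u v"
      using ip_uw semi_inner_product_commute[OF ip w u] by (rule trans[rotated])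
    have ip_ww: "ip ?w ?w = t\<^sup>2 * ip v v"
      unfolding semi_inner_product_smult_left[OF ip v w] semi_inner_product_smult_right[OF ip v v]
      by (simp add: power2_eq_square)
    show ?thesis
      unfolding ip_uw ip_wu ip_ww by simp
  qed
  finally show ?thesis .
qed

lemma sq_seminorm:
  assumes "semi_inner_product n ip" "u \<in> carrier_vec n"
  shows "(seminorm ip u)\<^sup>2 = ip u u"
  using semi_inner_product_nonneg[OF assms] by (simp add: seminorm_def)

lemma seminorm_nonneg:
  assumes "semi_inner_product n ip" "u \<in> carrier_vec n"
  shows "0 \<le> seminorm ip u"
  using semi_inner_product_nonneg[OF assms] by (simp add: seminorm_def)

lemma seminorm_smult:
  assumes "semi_inner_product n ip" "u \<in> carrier_vec n"
  shows "seminorm ip (c \<cdot>\<^sub>v u) = \<bar>c\<bar> * seminorm ip u"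
proof -
  have "ip (c \<cdot>\<^sub>v u) (c \<cdot>\<^sub>v u) = c\<^sup>2 * ip u u"
    using assms semi_inner_product_smult_left[of n ip u "c \<cdot>\<^sub>v u" c]
      semi_inner_product_smult_right[of n ip u u c]
    by (simp add: power2_eq_square)
  then show ?thesis
    by (simp add: seminorm_def real_sqrt_mult)
qed

text \<open>
  A nonzero value \<open>ip u v\<close> would make the affine function \<open>t \<mapsto> |u + t v|\<^sup>2\<close> negative somewhere.
\<close>

lemma semi_inner_product_eq_0_of_null:
  assumes ip: "semi_inner_product n ip" and u: "u \<in> carrier_vec n" and v: "v \<in> carrier_vec n"
    and null: "ip v v = 0"
  shows "ip u v = 0"
proof (rule ccontr)
  assume nz: "ip u v \<noteq> 0"
  define t where "t = - (ip u u + 1) / (2 * ip u v)"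
  have "0 \<le> ip (u + t \<cdot>\<^sub>v v) (u + t \<cdot>\<^sub>v v)"
    using ip u v by (intro semi_inner_product_nonneg) auto
  also have "\<dots> = ip u u + 2 * t * ip u v"
    using semi_inner_product_add_smult_self[OF ip u v] null by simp
  also have "\<dots> = - 1"
    using nz by (simp add: t_def field_simps)
  finally show False by simp
qed

text \<open>
  Scaling \<open>v\<close> by a positive factor keeps its cosine with \<open>u\<close>, and on the ray through a \<open>v\<close> with
  cosine \<open>c \<ge> 0\<close> the point closest to \<open>u\<close> has length \<open>c |u|\<close>: complete the square in \<open>|v|\<close>. The cosine of a \<open>v\<close> of length \<open>0\<close>
  is the default value \<open>0\<close>, which is the right one here because such a \<open>v\<close> is orthogonal to \<open>u\<close>.
\<close>

lemma sq_norm_diff_ge_of_cosine_le: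
  assumes ip: "semi_inner_product n ip" and u: "u \<in> carrier_vec n" and v: "v \<in> carrier_vec n"
    and u_pos: "0 < seminorm ip u"
    and cosine: "ip u v / (seminorm ip u * seminorm ip v) \<le> c"
  shows "(1 - c\<^sup>2) * (seminorm ip u)\<^sup>2 \<le> (seminorm ip (u - v))\<^sup>2"
proof -
  let ?u = "seminorm ip u" and ?v = "seminorm ip v"
  have inner: "ip u v \<le> c * (?u * ?v)"
  proof (cases "?v = 0")
    case True
    then have "ip v v = 0"
      by (simp add: seminorm_def)
    then show ?thesis
      using semi_inner_product_eq_0_of_null[OF ip u v] True by simp
  next
    case False
    then have "0 < ?u * ?v"
      using u_pos seminorm_nonneg[OF ip v] by simp
    then show ?thesis
      using cosine by (simp add: pos_divide_le_eq)
  qed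
  have "(1 - c\<^sup>2) * ?u\<^sup>2 \<le> (1 - c\<^sup>2) * ?u\<^sup>2 + (?v - c * ?u)\<^sup>2"
    by simp
  also have "\<dots> = ?u\<^sup>2 - 2 * (c * (?u * ?v)) + ?v\<^sup>2"
    by (simp add: power2_eq_square algebra_simps)
  also have "\<dots> \<le> ?u\<^sup>2 - 2 * ip u v + ?v\<^sup>2"
    using inner by simp
  also have "\<dots> = ip (u + (- 1) \<cdot>\<^sub>v v) (u + (- 1) \<cdot>\<^sub>v v)"
    using semi_inner_product_add_smult_self[OF ip u v, of "- 1"] sq_seminorm[OF ip u]
      sq_seminorm[OF ip v] by simp
  also have "u + (- 1) \<cdot>\<^sub>v v = u - v"
    using u v by auto
  also have "ip (u - v) (u - v) = (seminorm ip (u - v))\<^sup>2"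
    using sq_seminorm[OF ip] u v by simp
  finally show ?thesis .
qed


section \<open>Scaling the output of a network\<close>

definition scale_output ::
    "real \<Rightarrow> (real mat \<times> real vec) list \<Rightarrow> (real mat \<times> real vec) list" where
  "scale_output c Ws = Ws[length Ws - 1 := (c \<cdot>\<^sub>m fst (last Ws), c \<cdot>\<^sub>v snd (last Ws))]"

lemma length_scale_output [simp]: "length (scale_output c Ws) = length Ws"
  by (simp add: scale_output_def)

lemma scale_output_nth_last:
  assumes "Ws \<noteq> []"
  shows "scale_output c Ws ! (length Ws - 1) =
    (c \<cdot>\<^sub>m fst (Ws ! (length Ws - 1)), c \<cdot>\<^sub>v snd (Ws ! (length Ws - 1)))"
  using assms by (simp add: scale_output_def last_conv_nth)

lemma scale_output_nth_less:
  assumes "i < length Ws - 1"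
  shows "scale_output c Ws ! i = Ws ! i"
  using assms by (simp add: scale_output_def)

lemma dim_scale_output_nth:
  assumes "i < length Ws"
  shows "dim_row (fst (scale_output c Ws ! i)) = dim_row (fst (Ws ! i))"
    and "dim_col (fst (scale_output c Ws ! i)) = dim_col (fst (Ws ! i))"
    and "dim_vec (snd (scale_output c Ws ! i)) = dim_vec (snd (Ws ! i))"
proof -
  have "i < length Ws - 1 \<or> i = length Ws - 1" "Ws \<noteq> []"
    using assms by auto
  then show "dim_row (fst (scale_output c Ws ! i)) = dim_row (fst (Ws ! i))"
    and "dim_col (fst (scale_output c Ws ! i)) = dim_col (fst (Ws ! i))"
    and "dim_vec (snd (scale_output c Ws ! i)) = dim_vec (snd (Ws ! i))"
    by (auto simp: scale_output_nth_last scale_output_nth_less simp del: One_nat_def)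
qed

lemma weight_setD:
  assumes "Ws \<in> weight_set \<chi>" "i < length Ws"
  shows "fst (Ws ! i) \<in> carrier_mat (\<chi> ! Suc i) (\<chi> ! i)" "snd (Ws ! i) \<in> carrier_vec (\<chi> ! Suc i)"
  using assms unfolding weight_set_def by blast+

lemma scale_output_in_weight_set:
  assumes "Ws \<in> weight_set \<chi>"
  shows "scale_output c Ws \<in> weight_set \<chi>"
proof -
  have "fst (scale_output c Ws ! i) \<in> carrier_mat (\<chi> ! Suc i) (\<chi> ! i)"
    and "snd (scale_output c Ws ! i) \<in> carrier_vec (\<chi> ! Suc i)" if i: "i < length Ws" for i
    using weight_setD[OF assms i] dim_scale_output_nth[OF i, of c]
    by (auto intro!: carrier_matI carrier_vecI)
  moreover have "length Ws = length \<chi> - 1"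
    using assms by (simp add: weight_set_def)
  ultimately show ?thesis
    by (simp add: weight_set_def)
qed

lemma layer_carrier:
  assumes "Ws \<in> weight_set \<chi>" "i < length Ws"
  shows "layer \<delta> Ws i x \<in> carrier_vec (\<chi> ! Suc i)"
proof -
  have "dim_vec (snd (Ws ! i)) = \<chi> ! Suc i"
    using weight_setD(2)[OF assms] by simp
  then show ?thesis
    by (cases i) (auto intro: carrier_vecI)
qed

lemma layer_scale_output_less:
  assumes "i < length Ws - 1"
  shows "layer \<delta> (scale_output c Ws) i x = layer \<delta> Ws i x"
  using assms by (induction i) (simp_all add: scale_output_nth_less)

lemma affine_map_smult:
  fixes A :: "real mat"
  assumes "A \<in> carrier_mat k m" "b \<in> carrier_vec k" "v \<in> carrier_vec m"
  shows "(c \<cdot>\<^sub>m A) *\<^sub>v v + c \<cdot>\<^sub>v b = c \<cdot>\<^sub>v (A *\<^sub>v v + b)"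
  using assms by (intro eq_vecI) (auto simp: algebra_simps)

lemma layer_scale_output_last:
  assumes Ws: "Ws \<in> weight_set \<chi>" and k: "length Ws = Suc k" and x: "x \<in> carrier_vec (\<chi> ! 0)"
  shows "layer \<delta> (scale_output c Ws) k x = c \<cdot>\<^sub>v layer \<delta> Ws k x"
proof -
  have last: "scale_output c Ws ! k = (c \<cdot>\<^sub>m fst (Ws ! k), c \<cdot>\<^sub>v snd (Ws ! k))"
    using scale_output_nth_last[of Ws c] k by force
  have A: "fst (Ws ! k) \<in> carrier_mat (\<chi> ! Suc k) (\<chi> ! k)"
    and b: "snd (Ws ! k) \<in> carrier_vec (\<chi> ! Suc k)"
    using weight_setD[OF Ws, of k] k by simp_all
  show ?thesis
  proof (cases k)
    case 0
    show ?thesis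
      using affine_map_smult[OF A b, of x c] x last unfolding 0 by simp
  next
    case (Suc i)
    have i: "i < length Ws" "i < length Ws - 1"
      using k Suc by auto
    have v: "map_vec (relu \<delta>) (layer \<delta> Ws i x) \<in> carrier_vec (\<chi> ! k)"
      using layer_carrier[OF Ws i(1)] unfolding Suc by simp
    show ?thesis
      using affine_map_smult[OF A b v, of c] last layer_scale_output_less[OF i(2), of \<delta> c x]
      unfolding Suc by simp
  qed
qed

lemma weight_set_shape:
  assumes "architecture m \<chi>" "Ws \<in> weight_set \<chi>"
  shows "Ws \<noteq> []" "\<chi> ! 0 = m" "\<chi> ! length Ws = 1"
proof -
  have "\<chi> \<noteq> []"
    using assms by (auto simp: architecture_def)
  then show "Ws \<noteq> []" "\<chi> ! 0 = m" "\<chi> ! length Ws = 1"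
    using assms by (auto simp: architecture_def weight_set_def hd_conv_nth last_conv_nth)
qed

lemma realization_scale_output:
  assumes \<chi>: "architecture m \<chi>" and Ws: "Ws \<in> weight_set \<chi>"
  shows "realization \<delta> (scale_output c Ws) = fun_scale m c (realization \<delta> Ws)"
proof -
  note arch = weight_set_shape[OF \<chi> Ws]
  obtain k where k: "length Ws = Suc k"
    using arch(1) by (cases Ws) auto
  have cols: "dim_col (fst (Ws ! 0)) = m"
    using weight_setD(1)[OF Ws, of 0] arch by auto
  then have cols': "dim_col (fst (scale_output c Ws ! 0)) = m"
    using dim_scale_output_nth(2)[of 0 Ws c] arch(1) by simp
  have out: "layer \<delta> (scale_output c Ws) k z $ 0 = c * layer \<delta> Ws k z $ 0"
    if z: "z \<in> carrier_vec m" for z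
  proof -
    have "dim_vec (layer \<delta> Ws k z) = 1"
      using layer_carrier[OF Ws, of k \<delta> z] arch(3) k by simp
    then show ?thesis
      using layer_scale_output_last[OF Ws k, of z \<delta> c] z arch(2) by simp
  qed
  show ?thesis
    unfolding realization_def fun_scale_def length_scale_output cols cols' k diff_Suc_1
    using out by (intro restrict_ext) simp
qed


section \<open>The data vectors of networks\<close>

lemma data_vec_carrier [simp]: "data_vec n x H F \<in> carrier_vec n"
  by (simp add: data_vec_def)

lemma realization_in_network_functions:
  assumes "architecture m \<chi>" "Ws \<in> weight_set \<chi>"
  shows "realization \<delta> Ws \<in> network_functions \<delta> m"
  using assms by (auto simp: network_functions_def realizations_def)

lemma data_vec_fun_plus:
  assumes "linear_operator \<delta> m H" "\<And>i. i < n \<Longrightarrow> x i \<in> carrier_vec m"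
    and "F \<in> network_functions \<delta> m" "G \<in> network_functions \<delta> m"
  shows "data_vec n x H (fun_plus m F G) = data_vec n x H F + data_vec n x H G"
proof -
  have "H (fun_plus m F G) = fun_plus m (H F) (H G)"
    using assms(1,3,4) unfolding linear_operator_def by blast
  then show ?thesis
    using assms(2) by (intro eq_vecI) (simp_all add: data_vec_def fun_plus_def)
qed

lemma data_vec_fun_scale:
  assumes "linear_operator \<delta> m H" "\<And>i. i < n \<Longrightarrow> x i \<in> carrier_vec m"
    and "F \<in> network_functions \<delta> m"
  shows "data_vec n x H (fun_scale m c F) = c \<cdot>\<^sub>v data_vec n x H F"
proof -
  have "H (fun_scale m c F) = fun_scale m c (H F)"
    using assms(1,3) unfolding linear_operator_def by blast
  then show ?thesis
    using assms(2) by (intro eq_vecI) (simp_all add: data_vec_def fun_scale_def)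
qed

lemma num_params_pos:
  assumes "architecture m \<chi>"
  shows "0 < num_params \<chi>"
proof -
  have "(\<chi> ! 0 + 1) * \<chi> ! Suc 0 \<le> num_params \<chi>"
    unfolding num_params_def
    using assms by (intro member_le_sum[where f = "\<lambda>i. (\<chi> ! i + 1) * \<chi> ! Suc i"])
      (auto simp: architecture_def)
  moreover have "0 < (\<chi> ! 0 + 1) * \<chi> ! Suc 0"
    using assms by (auto simp: architecture_def)
  ultimately show ?thesis
    by (rule less_le_trans[rotated])
qed


section \<open>The alignment of an optimal network\<close>

text \<open>
  If \<open>0 < |h| < 1\<close> for \<open>h = \<^bold>H\<R>(\<W>\<^sup>\<star>)\<close>, then \<open>h / |h|\<close> is the data vector of a feasible competitor.
  The maximum \<open>r \<cdot> h\<close> thus dominates \<open>r \<cdot> h / |h|\<close>, which is \<open>|r|\<close> times the cosine.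
  Positivity of the cosine ensures \<open>|h| \<noteq> 0\<close>.
\<close>

lemma alignment_optimal_le:
  assumes x: "\<And>i. i < n \<Longrightarrow> x i \<in> carrier_vec m" and y: "y \<in> carrier_vec n"
    and ip: "semi_inner_product n ip" and H: "linear_operator \<delta> m H"
    and \<chi>: "architecture m \<chi>"
    and opt: "optimal_weights \<delta> n ip x y H F \<chi> W"
    and pos: "0 < alignment n ip x y H F (realization \<delta> W)"
  shows "alignment n ip x y H F (realization \<delta> W) \<le> C_opt \<delta> n ip x y H F W / 2"
proof -
  define r where "r = y - data_vec n x H F"
  define h where "h = data_vec n x H (realization \<delta> W)"
  have r: "r \<in> carrier_vec n" and h: "h \<in> carrier_vec n"
    using y by (simp_all add: r_def h_def)
  have W: "W \<in> weight_set \<chi>"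
    and max: "\<And>V. V \<in> weight_set \<chi> \<Longrightarrow> seminorm ip (data_vec n x H (realization \<delta> V)) \<le> 1
      \<Longrightarrow> ip r (data_vec n x H (realization \<delta> V)) \<le> ip r h"
    using opt by (auto simp: optimal_weights_def is_arg_max_linorder r_def h_def)
  have align: "alignment n ip x y H F (realization \<delta> W) = ip r h / (seminorm ip r * seminorm ip h)"
    by (simp add: alignment_def r_def h_def)
  have "seminorm ip r \<noteq> 0" "seminorm ip h \<noteq> 0"
    using pos align by auto
  then have norms: "0 < seminorm ip r" "0 < seminorm ip h"
    using seminorm_nonneg[OF ip] r h by (simp_all add: order_less_le)
  define V where "V = scale_output (1 / seminorm ip h) W"
  have "V \<in> weight_set \<chi>"
    unfolding V_def using W by (rule scale_output_in_weight_set)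
  moreover have V: "data_vec n x H (realization \<delta> V) = (1 / seminorm ip h) \<cdot>\<^sub>v h"
    unfolding V_def h_def realization_scale_output[OF \<chi> W]
    using H x realization_in_network_functions[OF \<chi> W] by (rule data_vec_fun_scale)
  moreover have "seminorm ip ((1 / seminorm ip h) \<cdot>\<^sub>v h) = 1"
    using seminorm_smult[OF ip h] norms by simp
  ultimately have "ip r ((1 / seminorm ip h) \<cdot>\<^sub>v h) \<le> ip r h"
    using max[of V] by simp
  then have "ip r h / seminorm ip h \<le> ip r h"
    using semi_inner_product_smult_right[OF ip r h] by simp
  then have "(ip r h / seminorm ip h) / seminorm ip r \<le> ip r h / seminorm ip r"
    using norms by (intro divide_right_mono) simp_all
  also have "\<dots> = C_opt \<delta> n ip x y H F W / 2"
    using norms by (simp add: C_opt_def loss_def r_def h_def)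
  finally show ?thesis
    by (simp add: align mult.commute)
qed

theorem theorem3p16:
  fixes \<delta> L :: real
    and w0 n :: nat
    and x :: "nat \<Rightarrow> real vec"
    and y :: "real vec"
    and ip :: "real vec \<Rightarrow> real vec \<Rightarrow> real"
    and H :: "(real vec \<Rightarrow> real) \<Rightarrow> real vec \<Rightarrow> real"
    and F G :: "real vec \<Rightarrow> real"
    and \<chi>opt \<chi> :: "nat list"
    and Wopt :: "(real mat \<times> real vec) list"
  assumes "0 \<le> \<delta>" and "\<delta> < 1"
    and "\<And>i. i < n \<Longrightarrow> x i \<in> carrier_vec w0"
    and "y \<in> carrier_vec n"
    and "semi_inner_product n ip"
    and "linear_operator \<delta> w0 H"
    and "F \<in> network_functions \<delta> w0"
    and "loss n ip x y H F > 0"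
    and "architecture w0 \<chi>opt"
    and "optimal_weights \<delta> n ip x y H F \<chi>opt Wopt"
    and "architecture w0 \<chi>"
    and "G \<in> realizations \<delta> \<chi>"
    and "L > 0"
    and "implication_I \<delta> n ip x y H F \<chi>opt Wopt \<chi> G L"
    and "C_opt \<delta> n ip x y H F Wopt \<noteq> 0 \<Longrightarrow>
           real (num_params \<chi>) / real (num_params \<chi>opt)
             \<le> 1 / (16 * L\<^sup>2 * (C_opt \<delta> n ip x y H F Wopt)\<^sup>2)"
  shows "loss n ip x y H F \<le> 2 * loss n ip x y H (fun_plus w0 F G)"
proof -
  define r where "r = y - data_vec n x H F"
  define g where "g = data_vec n x H G"
  define C where "C = C_opt \<delta> n ip x y H F Wopt"
  define s where "s = sqrt (real (num_params \<chi>) / real (num_params \<chi>opt))"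
  let ?a = "alignment n ip x y H F G" and ?b = "alignment n ip x y H F (realization \<delta> Wopt)"
  have r: "r \<in> carrier_vec n" and g: "g \<in> carrier_vec n"
    using assms(4) by (simp_all add: r_def g_def)
  have loss_F: "loss n ip x y H F = (seminorm ip r)\<^sup>2"
    by (simp add: loss_def r_def)
  have "G \<in> network_functions \<delta> w0"
    using assms(11,12) by (auto simp: network_functions_def)
  then have "data_vec n x H (fun_plus w0 F G) = data_vec n x H F + g"
    unfolding g_def using assms(3,6,7) by (intro data_vec_fun_plus)
  moreover have "y - (data_vec n x H F + g) = r - g"
    using assms(4) g unfolding r_def by (intro eq_vecI) (auto simp: data_vec_def)
  ultimately have loss_FG: "loss n ip x y H (fun_plus w0 F G) = (seminorm ip (r - g))\<^sup>2"
    by (simp add: loss_def)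
  have "?a \<le> 1 / 8"
  proof (cases "0 < ?a")
    case True
    have s: "0 < s"
      using num_params_pos[OF assms(9)] num_params_pos[OF assms(11)] by (simp add: s_def)
    then have Ls: "0 < L * s"
      using assms(13) by simp
    have b: "?a / (L * s) \<le> ?b"
      using assms(14) True by (auto simp: implication_I_def s_def)
    moreover have "0 < ?a / (L * s)"
      using True Ls by simp
    ultimately have "0 < ?b"
      by linarith
    then have bC: "?b \<le> C / 2"
      unfolding C_def using alignment_optimal_le[OF assms(3,4,5,6,9,10)] by simp
    then have C: "0 < C"
      using \<open>0 < ?b\<close> by linarith
    have "s\<^sup>2 \<le> 1 / (16 * L\<^sup>2 * C\<^sup>2)"
      using assms(15) C by (simp add: s_def C_def)
    also have "\<dots> = (1 / (4 * L * C))\<^sup>2"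
      by (simp add: power_divide power_mult_distrib)
    finally have "s \<le> 1 / (4 * L * C)"
      using assms(13) C by (simp add: power2_le_iff_abs_le s less_imp_le)
    then have sLC: "s * (4 * L * C) \<le> 1"
      using assms(13) C by (simp add: pos_le_divide_eq)
    have "?a / (L * s) \<le> C / 2"
      using b bC by linarith
    then have "?a \<le> C / 2 * (L * s)"
      using Ls by (simp only: pos_divide_le_eq)
    also have "\<dots> = s * (4 * L * C) / 8"
      by simp
    finally show ?thesis
      using sLC by linarith
  qed simp
  then have "ip r g / (seminorm ip r * seminorm ip g) \<le> 1 / 8"
    by (simp add: alignment_def r_def g_def)
  moreover have "0 < seminorm ip r"
    using assms(8) seminorm_nonneg[OF assms(5) r] by (simp add: loss_F order_less_le)
  ultimately have "(1 - (1 / 8)\<^sup>2) * (seminorm ip r)\<^sup>2 \<le> (seminorm ip (r - g))\<^sup>2"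
    using sq_norm_diff_ge_of_cosine_le[OF assms(5) r g] by blast
  moreover have "1 - (1 / 8)\<^sup>2 = (63 / 64 :: real)"
    by (simp add: power2_eq_square)
  ultimately have "63 / 64 * (seminorm ip r)\<^sup>2 \<le> (seminorm ip (r - g))\<^sup>2"
    by simp
  then show ?thesis
    unfolding loss_F loss_FG using zero_le_power2[of "seminorm ip r"] by linarith
qed

end
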